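(* Let $\mathcal{G}_0=(G_0,m,\varphi,\tau)$ be a $\Gamma$-gain framework and let $T=(d\tau(\gamma_1),\ldots,d\tau(\gamma_n))$ (with $\gamma_1,\dots,\gamma_n\in\Gamma$) be a generating $n$-tuple for the group $d\tau(\Gamma)$. If $\lambda=(\lambda_1,\ldots,\lambda_n)\in\sigma(T)$ is a joint eigenvalue for $T$ with a joint eigenvector $a\in X$, then the vector $[a\,\cdots\,a]^\intercal\in X^{V_0}$ (all of whose components equal $a$) lies in $\ker O_{\mathcal{G}_0}(\bar\chi_\lambda)$. In particular, $\Omega_{js}(\tau)$ is a non-empty subset of the RUM spectrum $\Omega(\mathcal{G}_0)$.
   Context: $X$ and $Y$ are finite-dimensional complex Hilbert spaces with $X\neq\{0\}$; $\Gamma$ is a finitely generated discrete abelian group written additively; $\hat\Gamma$ is its dual group of characters $\chi:\Gamma\to\mathbb{T}$. $\mathrm{Isom}(X)$ is the group of affine isometries of $X$ (maps $x\mapsto Ux+b$ with $U$ a linear isometry, $b\in X$). For a group homomorphism $\tau:\Gamma\to\mathrm{Isom}(X)$, $d\tau(\gamma)$ denotes the linear part of $\tau(\gamma)$; $d\tau$ is a unitary representation of $\Gamma$ on $X$. A $\Gamma$-gain framework is a tuple $\mathcal{G}_0=(G_0,m,\varphi,\tau)$ where $G_0=(V_0,E_0)$ is a finite directed multigraph with $V_0\ne\emptyset$ (loops and parallel edges allowed), $m:E_0\to\Gamma$, $e\mapsto m_e$, is any map, $\varphi=(\varphi_e)_{e\in E_0}$ is a family of linear maps $X\to Y$, and $\tau:\Gamma\to\mathrm{Isom}(X)$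 is a group homomorphism. The source and range of $e\in E_0$ are denoted $s(e)$ and $r(e)$. For $\chi\in\hat\Gamma$ the orbit matrix is the linear map $O_{\mathcal{G}_0}(\chi):X^{V_0}\to Y^{E_0}$ given by $(O_{\mathcal{G}_0}(\chi)a)_e=\varphi_e\big(a_{s(e)}-\chi(m_e)\,d\tau(m_e)a_{r(e)}\big)$ for $e\in E_0$. The RUM spectrum is $\Omega(\mathcal{G}_0)=\{\chi\in\hat\Gamma:\ker O_{\mathcal{G}_0}(\chi)\ne\{0\}\}$. Joint spectrum: for a commuting tuple $T=(T_1,\dots,T_n)$ of linear operators on $X$, $\sigma(T)$ is the set of joint eigenvalues, i.e. points $\lambda\in\mathbb{C}^n$ for which there is a non-zero $a\in X$ (a joint eigenvector for $\lambda$) with $T_ja=\lambda_ja$ for all $j$. If $\mathcal{A}$ is the unital commutative Banach algebra generated by $T_1,\dots,T_n$ in $B(X)$, then for each $\lambda\in\sigma(T)$ there is a unique non-zero multiplicative linear functional $\psi_\lambda:\mathcal{A}\to\mathbb{C}$ with $\lambda=(\psi_\lambda(T_1),\dots,\psi_\lambda(T_n))$. A generating $n$-tuple for $d\tau(\Gamma)$ is a tuple $T=(d\tau(\gamma_1),\dots,d\tau(\gamma_n))$ whose entries generate the group $d\tau(\Gamma)$. For such $T$ and $\lambda\in\sigma(T)$, $\chi_\lambda:=\psi_\lambda\circ d\tau\in\hat\Gamma$, and $\Omega_{js}(\tau):=\{\bar\chi_\lambda:\lambda\in\sigma(T)\}$, the set of joint spectral points for $\tau$, which does not depend on the choice of generating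 tuple $T$. *)

theory Defs
  imports
    "HOL-Analysis.Analysis"
    "HOL-Algebra.Bij"
    "HOL-Algebra.Generated_Groups"
    "HOL-Computational_Algebra.Group_Closure"
    "Graph_Theory.Digraph"
begin

unbundle no vec_syntax

section \<open>Finite-dimensional complex Hilbert spaces\<close>

text \<open>
  The norm, the metric and the real part of the Hermitian product are those of the library class
  \<open>real_inner\<close>. Completeness is automatic in finite dimension. The space \<open>{0}\<close> is allowed.
\<close>

class complex_inner = real_inner +
  fixes scaleC :: "complex \<Rightarrow> 'a \<Rightarrow> 'a"  (infixr \<open>*\<^sub>C\<close> 75)
    and cinner :: "'a \<Rightarrow> 'a \<Rightarrow> complex"
  assumes scaleC_add_right: "c *\<^sub>C (x + y) = c *\<^sub>C x + c *\<^sub>C y"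
    and scaleC_add_left: "(c + d) *\<^sub>C x = c *\<^sub>C x + d *\<^sub>C x"
    and scaleC_scaleC: "c *\<^sub>C d *\<^sub>C x = (c * d) *\<^sub>C x"
    and scaleC_one: "1 *\<^sub>C x = x"
    and scaleR_scaleC: "r *\<^sub>R x = complex_of_real r *\<^sub>C x"
    and cinner_commute: "cinner x y = cnj (cinner y x)"
    and cinner_add_left: "cinner (x + y) z = cinner x z + cinner y z"
    and cinner_scaleC_left: "cinner (c *\<^sub>C x) y = c * cinner x y"
    and Re_cinner: "Re (cinner x y) = inner x y"

class fd_complex_hilbert = complex_inner +
  assumes finite_dimensional: "\<exists>B. finite B \<and> (\<forall>x. \<exists>f. x = (\<Sum>b\<in>B. f b *\<^sub>C b))"

abbreviation clinear :: "('x::complex_inner \<Rightarrow> 'y::complex_inner) \<Rightarrow> bool"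
  where "clinear \<equiv> Vector_Spaces.linear scaleC scaleC"

section \<open>Affine isometries and characters\<close>

definition linear_isometry :: "('x::complex_inner \<Rightarrow> 'x) \<Rightarrow> bool"
  where "linear_isometry U \<longleftrightarrow> clinear U \<and> (\<forall>x. norm (U x) = norm x)"

definition Isom :: "('x::complex_inner \<Rightarrow> 'x) set"
  where "Isom = {f. \<exists>U b. linear_isometry U \<and> (\<forall>x. f x = U x + b)}"

definition linear_part :: "('x::complex_inner \<Rightarrow> 'x) \<Rightarrow> ('x \<Rightarrow> 'x)"
  where "linear_part f = (THE U. linear_isometry U \<and> (\<exists>b. \<forall>x. f x = U x + b))"

definition isom_hom :: "('g::ab_group_add \<Rightarrow> 'x::complex_inner \<Rightarrow> 'x) \<Rightarrow> bool"
  where "isom_hom \<tau> \<longleftrightarrow> (\<forall>\<gamma>. \<tau> \<gamma> \<in> Isom) \<and> (\<forall>\<gamma> \<delta>. \<tau> (\<gamma> + \<delta>) = \<tau> \<gamma> \<circ> \<tau> \<delta>)"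

text \<open>The linear part \<open>d\<tau>\<close> of \<open>\<tau>\<close>.\<close>

definition lin_rep :: "('g \<Rightarrow> 'x::complex_inner \<Rightarrow> 'x) \<Rightarrow> 'g \<Rightarrow> 'x \<Rightarrow> 'x"
  where "lin_rep \<tau> \<gamma> = linear_part (\<tau> \<gamma>)"

definition dual_group :: "('g::ab_group_add \<Rightarrow> complex) set"
  where "dual_group = {\<chi>. (\<forall>\<gamma>. norm (\<chi> \<gamma>) = 1) \<and> (\<forall>\<gamma> \<delta>. \<chi> (\<gamma> + \<delta>) = \<chi> \<gamma> * \<chi> \<delta>)}"

definition cnj_char :: "('g \<Rightarrow> complex) \<Rightarrow> 'g \<Rightarrow> complex"
  where "cnj_char \<chi> \<gamma> = cnj (\<chi> \<gamma>)"

section \<open>Gain frameworks, orbit matrices and the RUM spectrum\<close>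

text \<open>
  The source and range of an edge are \<open>tail G e\<close> and \<open>head G e\<close>. The locale \<open>fin_digraph\<close>
  allows loops and parallel edges. The values of \<open>m\<close> and \<open>\<phi>\<close> outside \<open>arcs G\<close> are irrelevant.
\<close>

definition gain_framework ::
  "('v, 'e) pre_digraph \<Rightarrow> ('e \<Rightarrow> 'g::ab_group_add)
    \<Rightarrow> ('e \<Rightarrow> 'x::fd_complex_hilbert \<Rightarrow> 'y::fd_complex_hilbert)
    \<Rightarrow> ('g \<Rightarrow> 'x \<Rightarrow> 'x) \<Rightarrow> bool"
  where "gain_framework G m \<phi> \<tau> \<longleftrightarrow>
    fin_digraph G \<and> verts G \<noteq> {} \<and> m \<in> arcs G \<rightarrow> UNIV \<and> (\<forall>e\<in>arcs G. clinear (\<phi> e)) \<and> isom_hom \<tau>"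

text \<open>
  \<open>Z\<^sup>I\<close> is represented by \<open>I \<rightarrow>\<^sub>E UNIV\<close>, so that distinct functions represent distinct vectors.
\<close>

definition orbit_matrix ::
  "('v, 'e) pre_digraph \<Rightarrow> ('e \<Rightarrow> 'g) \<Rightarrow> ('e \<Rightarrow> 'x::fd_complex_hilbert \<Rightarrow> 'y::fd_complex_hilbert)
    \<Rightarrow> ('g \<Rightarrow> 'x \<Rightarrow> 'x) \<Rightarrow> ('g \<Rightarrow> complex) \<Rightarrow> ('v \<Rightarrow> 'x) \<Rightarrow> ('e \<Rightarrow> 'y)"
  where "orbit_matrix G m \<phi> \<tau> \<chi> a =
    (\<lambda>e\<in>arcs G. \<phi> e (a (tail G e) - \<chi> (m e) *\<^sub>C lin_rep \<tau> (m e) (a (head G e))))"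

definition orbit_kernel ::
  "('v, 'e) pre_digraph \<Rightarrow> ('e \<Rightarrow> 'g) \<Rightarrow> ('e \<Rightarrow> 'x::fd_complex_hilbert \<Rightarrow> 'y::fd_complex_hilbert)
    \<Rightarrow> ('g \<Rightarrow> 'x \<Rightarrow> 'x) \<Rightarrow> ('g \<Rightarrow> complex) \<Rightarrow> ('v \<Rightarrow> 'x) set"
  where "orbit_kernel G m \<phi> \<tau> \<chi> =
    {a \<in> verts G \<rightarrow>\<^sub>E UNIV. orbit_matrix G m \<phi> \<tau> \<chi> a = (\<lambda>e\<in>arcs G. 0)}"

definition RUM_spectrum ::
  "('v, 'e) pre_digraph \<Rightarrow> ('e \<Rightarrow> 'g::ab_group_add)
    \<Rightarrow> ('e \<Rightarrow> 'x::fd_complex_hilbert \<Rightarrow> 'y::fd_complex_hilbert)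
    \<Rightarrow> ('g \<Rightarrow> 'x \<Rightarrow> 'x) \<Rightarrow> ('g \<Rightarrow> complex) set"
  where "RUM_spectrum G m \<phi> \<tau> =
    {\<chi> \<in> dual_group. orbit_kernel G m \<phi> \<tau> \<chi> \<noteq> {\<lambda>v\<in>verts G. 0}}"

section \<open>Joint spectrum\<close>

text \<open>Tuples are lists; a joint eigenvalue \<open>(\<lambda>\<^sub>1, \<dots>, \<lambda>\<^sub>n)\<close> is written \<open>\<mu>s\<close>.\<close>

definition joint_eigenvector ::
  "('x::complex_inner \<Rightarrow> 'x) list \<Rightarrow> complex list \<Rightarrow> 'x \<Rightarrow> bool"
  where "joint_eigenvector T \<mu>s a \<longleftrightarrow>
    a \<noteq> 0 \<and> length \<mu>s = length T \<and> (\<forall>j<length T. (T ! j) a = (\<mu>s ! j) *\<^sub>C a)"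

definition joint_spectrum :: "('x::complex_inner \<Rightarrow> 'x) list \<Rightarrow> complex list set"
  where "joint_spectrum T = {\<mu>s. \<exists>a. joint_eigenvector T \<mu>s a}"

text \<open>
  Closedness is with respect to the operator norm \<open>onorm\<close>. On a finite-dimensional space
  \<open>B(X)\<close> consists of all linear operators.
\<close>

definition closed_unital_subalgebra :: "('x::fd_complex_hilbert \<Rightarrow> 'x) set \<Rightarrow> bool"
  where "closed_unital_subalgebra A \<longleftrightarrow>
    A \<subseteq> Collect clinear \<and> id \<in> A \<and>
    (\<forall>S\<in>A. \<forall>R\<in>A. (\<lambda>x. S x + R x) \<in> A) \<and>
    (\<forall>c. \<forall>S\<in>A. (\<lambda>x. c *\<^sub>C S x) \<in> A) \<and>
    (\<forall>S\<in>A. \<forall>R\<in>A. S \<circ> R \<in> A) \<and>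
    (\<forall>S R. (\<forall>n::nat. S n \<in> A) \<and> clinear R \<and> (\<lambda>n. onorm (\<lambda>x. S n x - R x)) \<longlonglongrightarrow> 0 \<longrightarrow> R \<in> A)"

definition generated_algebra :: "('x::fd_complex_hilbert \<Rightarrow> 'x) list \<Rightarrow> ('x \<Rightarrow> 'x) set"
  where "generated_algebra T = closed_unital_subalgebra hull set T"

text \<open>Functionals on \<open>A\<close> are taken extensional, so that the uniqueness behind the \<open>THE\<close> below can hold.\<close>

definition mult_functional ::
  "('x::fd_complex_hilbert \<Rightarrow> 'x) set \<Rightarrow> (('x \<Rightarrow> 'x) \<Rightarrow> complex) \<Rightarrow> bool"
  where "mult_functional A \<psi> \<longleftrightarrow>
    \<psi> \<in> extensional A \<and>
    (\<forall>S\<in>A. \<forall>R\<in>A. \<psi> (\<lambda>x. S x + R x) = \<psi> S + \<psi> R) \<and>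
    (\<forall>c. \<forall>S\<in>A. \<psi> (\<lambda>x. c *\<^sub>C S x) = c * \<psi> S) \<and>
    (\<forall>S\<in>A. \<forall>R\<in>A. \<psi> (S \<circ> R) = \<psi> S * \<psi> R) \<and>
    (\<exists>S\<in>A. \<psi> S \<noteq> 0)"

definition joint_functional ::
  "('x::fd_complex_hilbert \<Rightarrow> 'x) list \<Rightarrow> complex list \<Rightarrow> ('x \<Rightarrow> 'x) \<Rightarrow> complex"
  where "joint_functional T \<mu>s = (THE \<psi>. mult_functional (generated_algebra T) \<psi> \<and> \<mu>s = map \<psi> T)"

text \<open>
  A tuple of linear parts \<open>lin_rep \<tau> \<gamma>\<^sub>j\<close> is given through the list of the \<open>\<gamma>\<^sub>j\<close>. The group generated
  by its entries is taken inside the group of all bijections of the space.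
\<close>

definition lin_tuple :: "('g \<Rightarrow> 'x::fd_complex_hilbert \<Rightarrow> 'x) \<Rightarrow> 'g list \<Rightarrow> ('x \<Rightarrow> 'x) list"
  where "lin_tuple \<tau> \<gamma>s = map (lin_rep \<tau>) \<gamma>s"

definition generating_tuple :: "('g \<Rightarrow> 'x::fd_complex_hilbert \<Rightarrow> 'x) \<Rightarrow> 'g list \<Rightarrow> bool"
  where "generating_tuple \<tau> \<gamma>s \<longleftrightarrow>
    generate (BijGroup UNIV) (set (lin_tuple \<tau> \<gamma>s)) = range (lin_rep \<tau>)"

definition chi_joint ::
  "('g \<Rightarrow> 'x::fd_complex_hilbert \<Rightarrow> 'x) \<Rightarrow> 'g list \<Rightarrow> complex list \<Rightarrow> 'g \<Rightarrow> complex"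
  where "chi_joint \<tau> \<gamma>s \<mu>s = joint_functional (lin_tuple \<tau> \<gamma>s) \<mu>s \<circ> lin_rep \<tau>"

definition Omega_js ::
  "('g \<Rightarrow> 'x::fd_complex_hilbert \<Rightarrow> 'x) \<Rightarrow> 'g list \<Rightarrow> ('g \<Rightarrow> complex) set"
  where "Omega_js \<tau> \<gamma>s = {cnj_char (chi_joint \<tau> \<gamma>s \<mu>s) | \<mu>s. \<mu>s \<in> joint_spectrum (lin_tuple \<tau> \<gamma>s)}"

end

theory Submission
  imports Defs "HOL-Computational_Algebra.Fundamental_Theorem_Algebra"
begin

text \<open>
  The operators for which \<open>a\<close> is an eigenvector form a closed unital algebra, so a joint eigenvector
  \<open>a\<close> of the generators is an eigenvector of the whole generated algebra, and its eigenvalue there is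
  a multiplicative functional. Such functionals are contractive, hence determined by their
  values on the generators; so the eigenvalue functional is \<open>\<psi>\<^sub>\<lambda>\<close>. In finite dimension an injective
  operator has an inverse that is a polynomial in it, so \<open>d\<tau>(\<Gamma>)\<close> lies in the algebra and
  \<open>d\<tau>(\<gamma>)a = \<chi>\<^sub>\<lambda>(\<gamma>)a\<close>; each row of the orbit matrix at the conjugate character then
  kills the constant vector. Joint eigenvectors exist because commuting operators preserve each
  other's eigenspaces.
\<close>

section \<open>Complex scalars and complex-linear maps\<close>

interpretation cvs: vector_space "scaleC :: complex \<Rightarrow> 'a::complex_inner \<Rightarrow> 'a"
  by unfold_locales (auto simp: scaleC_add_right scaleC_add_left scaleC_scaleC scaleC_one)

lemma clinear_iff:
  "clinear f \<longleftrightarrow> (\<forall>x y. f (x + y) = f x + f y) \<and> (\<forall>c x. f (c *\<^sub>C x) = c *\<^sub>C f x)"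
  by (simp add: Vector_Spaces.linear_iff cvs.vector_space_axioms)

lemma clinear_add: "clinear f \<Longrightarrow> f (x + y) = f x + f y"
  and clinear_scaleC: "clinear f \<Longrightarrow> f (c *\<^sub>C x) = c *\<^sub>C f x"
  by (auto simp: clinear_iff)

lemma clinear_0: "clinear f \<Longrightarrow> f 0 = 0"
  using clinear_scaleC[of f 0 0] by simp

lemma clinear_diff: "clinear f \<Longrightarrow> f (x - y) = f x - f y"
  by (metis add_diff_cancel clinear_add diff_add_cancel)

lemma clinear_scaleR: "clinear f \<Longrightarrow> f (r *\<^sub>R x) = r *\<^sub>R f x"
  by (simp add: scaleR_scaleC clinear_scaleC)

lemma clinear_sum:
  assumes "clinear f" shows "f (\<Sum>i\<in>I. g i) = (\<Sum>i\<in>I. f (g i))"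
  by (induction I rule: infinite_finite_induct) (auto simp: clinear_add[OF assms] clinear_0[OF assms])

text \<open>The norm is tied to the product only through its real part: pulling \<open>c\<close> out
  of both arguments of \<open>cinner\<close> gives the factor \<open>c * cnj c\<close>, which is
  real, so it survives taking real parts.\<close>

lemma norm_scaleC: "norm (c *\<^sub>C x) = norm c * norm (x::'a::complex_inner)"
proof -
  have "cinner (c *\<^sub>C x) (c *\<^sub>C x) = (c * cnj c) * cinner x x"
    by (metis cinner_commute cinner_scaleC_left complex_cnj_mult mult.assoc)
  also have "\<dots> = of_real ((norm c)\<^sup>2) * cinner x x"
    by (simp only: complex_norm_square)
  finally have "Re (cinner (c *\<^sub>C x) (c *\<^sub>C x)) = (norm c)\<^sup>2 * Re (cinner x x)"
    by (simp del: of_real_power)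
  then have "(norm (c *\<^sub>C x))\<^sup>2 = (norm c * norm x)\<^sup>2"
    by (simp add: Re_cinner power_mult_distrib flip: power2_norm_eq_inner)
  then show ?thesis by simp
qed

section \<open>Linear maps on finite-dimensional spaces\<close>

text \<open>A finite complex spanning set \<open>B\<close> together with \<open>\<i>\<close> times
  \<open>B\<close> spans over the reals, and Gram-Schmidt makes it orthogonal. This gives access to
  the real notion of span.\<close>

lemma finite_real_spanning_set:
  "\<exists>C::'a::fd_complex_hilbert set. finite C \<and> span C = UNIV \<and> pairwise orthogonal C"
proof -
  obtain B :: "'a set" where B: "finite B" "\<And>x. \<exists>f. x = (\<Sum>b\<in>B. f b *\<^sub>C b)"
    using finite_dimensional by blast
  let ?B = "B \<union> scaleC \<i> ` B"
  have "x \<in> span ?B" for x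
  proof -
    obtain f where f: "x = (\<Sum>b\<in>B. f b *\<^sub>C b)" using B by blast
    have "f b *\<^sub>C b = Re (f b) *\<^sub>R b + Im (f b) *\<^sub>R (\<i> *\<^sub>C b)" for b
    proof -
      have "f b *\<^sub>C b = (of_real (Re (f b)) + of_real (Im (f b)) * \<i>) *\<^sub>C b"
        by (metis complex_eq mult.commute)
      then show ?thesis by (simp add: scaleR_scaleC scaleC_add_left)
    qed
    then show ?thesis unfolding f
      by (auto intro!: span_sum span_add span_scale intro: span_base)
  qed
  moreover obtain C where "finite C" "span C = span ?B" "pairwise orthogonal C"
    using basis_orthogonal[of ?B] B by auto
  ultimately show ?thesis by blast
qed

text \<open>By Cauchy-Schwarz, the coordinate of \<open>x\<close> along a non-zero member
  \<open>c\<close> of an orthogonal spanning set is at most \<open>norm x / norm c\<close>.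
  Boundedness is what makes \<open>onorm\<close> a genuine bound for linear maps.\<close>

lemma clinear_bounded_linear:
  fixes f :: "'a::fd_complex_hilbert \<Rightarrow> 'b::complex_inner"
  assumes f: "clinear f"
  shows "bounded_linear f"
proof -
  obtain C :: "'a set" where C: "finite C" "span C = UNIV" "pairwise orthogonal C"
    using finite_real_spanning_set by blast
  have bound: "norm (f x) \<le> norm x * (\<Sum>c\<in>C. norm (f c) / norm c)" for x
  proof -
    have "x \<in> span C" using C by simp
    then obtain u where u: "x = (\<Sum>c\<in>C. u c *\<^sub>R c)"
      unfolding span_finite[OF C(1)] by blast
    have le: "norm (u c *\<^sub>R f c) \<le> norm x * (norm (f c) / norm c)" if "c \<in> C" for c
    \<comment> \<open>An orthogonal set may contain 0. There both sides vanish, since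
      \<open>f 0 = 0\<close> and division by zero yields 0.\<close>
    proof (cases "c = 0")
      case True
      then show ?thesis using clinear_0[OF f] by simp
    next
      case False
      \<comment> \<open>Pairing with \<open>c\<close> isolates its coefficient by
        orthogonality.\<close>
      have "inner x c = (\<Sum>d\<in>C. if d = c then u c * inner c c else 0)"
        unfolding u inner_sum_left using C(3) that
        by (intro sum.cong) (auto simp: pairwise_def orthogonal_def)
      also have "\<dots> = u c * (norm c)\<^sup>2"
        using C that by (simp add: power2_norm_eq_inner)
      finally have "\<bar>u c\<bar> * (norm c)\<^sup>2 \<le> norm x * norm c"
        using Cauchy_Schwarz_ineq2[of x c] by (simp add: abs_mult)
      then have "\<bar>u c\<bar> \<le> norm x / norm c"
        using False by (simp add: field_simps power2_eq_square)
      then have "\<bar>u c\<bar> * norm (f c) \<le> norm x / norm c * norm (f c)"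
        by (rule mult_right_mono) simp
      then show ?thesis by simp
    qed
    have "f x = (\<Sum>c\<in>C. u c *\<^sub>R f c)"
      unfolding u clinear_sum[OF f] by (simp add: clinear_scaleR[OF f])
    then show ?thesis
      using sum_norm_le[of C "\<lambda>c. u c *\<^sub>R f c", OF le] by (simp add: sum_distrib_left)
  qed
  show ?thesis
    using clinear_add[OF f] clinear_scaleR[OF f] bound by (rule bounded_linear_intro)
qed

lemmas onorm_clinear = onorm[OF clinear_bounded_linear]
lemmas onorm_clinear_nonneg = onorm_pos_le[OF clinear_bounded_linear]

section \<open>Polynomials in an operator\<close>

text \<open>This is \<open>p(T) x\<close>, evaluated by Horner's scheme.\<close>

definition polyop :: "('a::complex_inner \<Rightarrow> 'a) \<Rightarrow> complex poly \<Rightarrow> 'a \<Rightarrow> 'a"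
  where "polyop T p x = fold_coeffs (\<lambda>a y. a *\<^sub>C x + T y) p 0"

lemma polyop_0 [simp]: "polyop T 0 x = 0"
  by (simp add: polyop_def)

context
  fixes T :: "'a::complex_inner \<Rightarrow> 'a"
  assumes T: "clinear T"
begin

lemma polyop_pCons: "polyop T (pCons a p) x = a *\<^sub>C x + T (polyop T p x)"
  by (cases "p = 0"; cases "a = 0") (auto simp: polyop_def clinear_0[OF T])

lemma polyop_add: "polyop T (p + q) x = polyop T p x + polyop T q x"
  by (induction p q rule: poly_induct2)
     (simp_all add: polyop_pCons scaleC_add_left clinear_add[OF T])

lemma polyop_smult: "polyop T (smult c p) x = c *\<^sub>C polyop T p x"
  by (induction p) (simp_all add: polyop_pCons scaleC_add_right clinear_scaleC[OF T])

lemma polyop_diff: "polyop T (p - q) x = polyop T p x - polyop T q x"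
proof -
  have "polyop T (p - q) x = polyop T (p + smult (-1) q) x" by simp
  also have "\<dots> = polyop T p x - polyop T q x"
    unfolding polyop_add polyop_smult by simp
  finally show ?thesis .
qed

lemma polyop_sum: "polyop T (\<Sum>i\<in>I. p i) x = (\<Sum>i\<in>I. polyop T (p i) x)"
  by (induction I rule: infinite_finite_induct) (auto simp: polyop_add)

lemma polyop_monom: "polyop T (monom c n) x = c *\<^sub>C (T ^^ n) x"
  by (induction n) (simp_all add: monom_0 monom_Suc polyop_pCons clinear_0[OF T] clinear_scaleC[OF T])

lemma polyop_mult: "polyop T (p * q) x = polyop T p (polyop T q x)"
  by (induction p) (simp_all add: polyop_pCons polyop_add polyop_smult)

lemma polyop_commute: "T (polyop T p x) = polyop T p (T x)"
  by (induction p) (simp_all add: polyop_pCons clinear_0[OF T] clinear_add[OF T] clinear_scaleC[OF T])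

lemma polyop_clinear: "clinear (polyop T p)"
  by (induction p)
     (simp_all add: clinear_iff polyop_pCons clinear_add[OF T] clinear_scaleC[OF T]
        scaleC_add_right mult.commute add_ac)

lemma polyop_mem_subspace:
  assumes "cvs.subspace W" "T ` W \<subseteq> W" "x \<in> W"
  shows "polyop T p x \<in> W"
  using assms
  by (induction p) (auto simp: polyop_pCons cvs.subspace_0 intro!: cvs.subspace_add cvs.subspace_scale)

end

section \<open>Annihilating polynomials\<close>

text \<open>Either two iterates of \<open>x\<close> coincide, and a difference of monomials works,
  or the iterates form an infinite set inside a finite-dimensional space, and a linear dependence
  among them is read as a polynomial.\<close>

lemma annihilating_poly_vector:
  fixes x :: "'a::fd_complex_hilbert"
  assumes T: "clinear T"
  shows "\<exists>p. p \<noteq> 0 \<and> polyop T p x = 0"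
proof (cases "inj (\<lambda>n. (T ^^ n) x)")
  case False
  then obtain i j where ij: "i \<noteq> j" "(T ^^ i) x = (T ^^ j) x"
    unfolding inj_def by blast
  have "coeff (monom 1 i - monom 1 j :: complex poly) i = 1"
    using ij by simp
  then have "monom 1 i - monom 1 j \<noteq> (0 :: complex poly)" by force
  then show ?thesis using ij
    by (intro exI[of _ "monom 1 i - monom 1 j"]) (simp add: polyop_diff[OF T] polyop_monom[OF T])
next
  case inj: True
  obtain B :: "'a set" where B: "finite B" "\<And>x. \<exists>f. x = (\<Sum>b\<in>B. f b *\<^sub>C b)"
    using finite_dimensional by blast
  let ?R = "range (\<lambda>n. (T ^^ n) x)"
  have "y \<in> cvs.span B" for y
  proof -
    obtain f where "y = (\<Sum>b\<in>B. f b *\<^sub>C b)" using B(2) by blast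
    then show ?thesis by (auto intro!: cvs.span_sum cvs.span_scale intro: cvs.span_base)
  qed
  then have "cvs.dependent ?R"
    using cvs.independent_span_bound[OF B(1), of ?R] range_inj_infinite[OF inj] by blast
  then obtain S u v where S: "finite S" "S \<subseteq> ?R" "(\<Sum>v\<in>S. u v *\<^sub>C v) = 0" "v \<in> S" "u v \<noteq> 0"
    unfolding cvs.dependent_explicit by blast
  obtain I where I: "S = (\<lambda>n. (T ^^ n) x) ` I"
    using S(2) by (auto simp: subset_image_iff)
  have "finite I" using S(1) I inj by (metis finite_imageD inj_on_subset subset_UNIV)
  obtain k where k: "k \<in> I" "v = (T ^^ k) x" using S(4) I by blast
  \<comment> \<open>Injectivity gives each vector of the relation a single exponent, so no
    coefficients merge and \<open>?p\<close> keeps the non-zero coefficient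
    \<open>u v\<close>.\<close>
  let ?p = "\<Sum>n\<in>I. monom (u ((T ^^ n) x)) n"
  have "coeff ?p k = u v"
    using k \<open>finite I\<close> by (simp add: coeff_sum)
  then have "?p \<noteq> 0" using S(5) by force
  moreover have "polyop T ?p x = (\<Sum>v\<in>S. u v *\<^sub>C v)"
    unfolding I polyop_sum[OF T] polyop_monom[OF T]
    using inj by (subst sum.reindex) (auto intro: inj_on_subset)
  ultimately show ?thesis using S(3) by metis
qed

text \<open>If \<open>p\<close> works for \<open>B\<close> and \<open>q\<close> annihilates the
  vector \<open>p(T) b\<close>, then \<open>q * p\<close> works for \<open>insert b B\<close>,
  because \<open>q(T)\<close> is linear and sends 0 to 0.\<close>

lemma annihilating_poly_finite:
  fixes B :: "'a::fd_complex_hilbert set"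
  assumes T: "clinear T" and "finite B"
  shows "\<exists>p. p \<noteq> 0 \<and> (\<forall>b\<in>B. polyop T p b = 0)"
  using assms(2)
proof induction
  case empty
  then show ?case by (auto intro: exI[of _ 1])
next
  case (insert b B)
  then obtain p where p: "p \<noteq> 0" "\<forall>b\<in>B. polyop T p b = 0" by blast
  obtain q where q: "q \<noteq> 0" "polyop T q (polyop T p b) = 0"
    using annihilating_poly_vector[OF T] by blast
  show ?case using p q
    by (intro exI[of _ "q * p"]) (auto simp: polyop_mult[OF T] clinear_0[OF polyop_clinear[OF T]])
qed

lemma annihilating_poly:
  fixes T :: "'a::fd_complex_hilbert \<Rightarrow> 'a"
  assumes T: "clinear T"
  shows "\<exists>p. p \<noteq> 0 \<and> (\<forall>x. polyop T p x = 0)"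
proof -
  obtain B :: "'a set" where B: "finite B" "\<And>x. \<exists>f. x = (\<Sum>b\<in>B. f b *\<^sub>C b)"
    using finite_dimensional by blast
  obtain p where p: "p \<noteq> 0" "\<forall>b\<in>B. polyop T p b = 0"
    using annihilating_poly_finite[OF T B(1)] by blast
  note lin = polyop_clinear[OF T, of p]
  have "polyop T p x = 0" for x
  proof -
    obtain f where f: "x = (\<Sum>b\<in>B. f b *\<^sub>C b)" using B by blast
    show ?thesis unfolding f clinear_sum[OF lin] by (simp add: clinear_scaleC[OF lin] p)
  qed
  with p show ?thesis by blast
qed

section \<open>Common eigenvectors of commuting operators\<close>

text \<open>Take \<open>p\<close> of least degree with \<open>p(T) x = 0\<close> and a root
  \<open>c\<close>, and write \<open>p = (X - c) q\<close>. By minimality \<open>q(T) x\<close> is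
  non-zero, \<open>T - c\<close> kills it, and invariance keeps it in \<open>W\<close>.\<close>

lemma eigenvector_in_subspace:
  fixes T :: "'a::fd_complex_hilbert \<Rightarrow> 'a"
  assumes T: "clinear T" and W: "cvs.subspace W" "T ` W \<subseteq> W" "x \<in> W" "x \<noteq> 0"
  shows "\<exists>a c. a \<in> W \<and> a \<noteq> 0 \<and> T a = c *\<^sub>C a"
proof -
  define P where "P p \<longleftrightarrow> p \<noteq> 0 \<and> polyop T p x = 0" for p
  obtain p where p: "P p" "\<And>q. P q \<Longrightarrow> degree p \<le> degree q"
    using annihilating_poly_vector[OF T, of x] ex_has_least_nat[of P _ degree] unfolding P_def by blast
  \<comment> \<open>A non-zero constant cannot annihilate \<open>x \<noteq> 0\<close>; so the
    fundamental theorem of algebra provides a root.\<close>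
  have "degree p \<noteq> 0"
  proof
    assume "degree p = 0"
    then obtain c where "p = [:c:]" by (metis degree_eq_zeroE)
    then show False using p(1) W(4) by (auto simp: P_def polyop_pCons[OF T] clinear_0[OF T])
  qed
  then obtain c where "poly p c = 0"
    using fundamental_theorem_of_algebra[of p] by (auto simp: constant_degree)
  then obtain q where q: "p = [:-c, 1:] * q"
    using poly_eq_0_iff_dvd dvd_def by metis
  have "q \<noteq> 0" using p(1) q by (auto simp: P_def)
  then have "degree p = degree q + 1" unfolding q by (subst degree_mult_eq) auto
  then have "polyop T q x \<noteq> 0" using p(2)[of q] \<open>q \<noteq> 0\<close> by (auto simp: P_def)
  moreover have "T (polyop T q x) = c *\<^sub>C polyop T q x"
    using p(1) unfolding P_def q
    by (simp add: polyop_add[OF T] polyop_smult[OF T] polyop_diff[OF T] polyop_pCons[OF T])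
  ultimately show ?thesis using polyop_mem_subspace[OF T W(1-3)] by blast
qed

text \<open>Induction on the list with \<open>W\<close> arbitrary: an eigenspace of the first
  operator inside \<open>W\<close> is non-zero and, by commutation, invariant under the remaining
  ones, so it takes the place of \<open>W\<close>.\<close>

lemma common_eigenvector:
  fixes Ts :: "('a::fd_complex_hilbert \<Rightarrow> 'a) list"
  assumes "\<forall>S\<in>set Ts. clinear S" "\<forall>S\<in>set Ts. \<forall>R\<in>set Ts. S \<circ> R = R \<circ> S"
    and "cvs.subspace W" "\<forall>S\<in>set Ts. S ` W \<subseteq> W" "x \<in> W" "x \<noteq> 0"
  shows "\<exists>a\<in>W. a \<noteq> 0 \<and> (\<forall>S\<in>set Ts. \<exists>c. S a = c *\<^sub>C a)"
  using assms
proof (induction Ts arbitrary: W x)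
  case Nil
  then show ?case by auto
next
  case (Cons T Ts)
  have T: "clinear T" using Cons.prems by simp
  have "T ` W \<subseteq> W" using Cons.prems by simp
  from eigenvector_in_subspace[OF T Cons.prems(3) this Cons.prems(5,6)]
  obtain b c where b: "b \<in> W" "b \<noteq> 0" "T b = c *\<^sub>C b" by blast
  define W' where "W' = {y \<in> W. T y = c *\<^sub>C y}"
  have "cvs.subspace W'"
    using Cons.prems(3) unfolding cvs.subspace_def W'_def
    by (auto simp: clinear_0[OF T] clinear_add[OF T] clinear_scaleC[OF T] scaleC_add_right mult.commute)
  moreover have "S ` W' \<subseteq> W'" if S: "S \<in> set Ts" for S
  proof -
    have "T (S y) = S (T y)" for y
      using Cons.prems(2) S by (metis comp_apply list.set_intros)
    moreover have "clinear S" "S ` W \<subseteq> W" using Cons.prems S by auto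
    ultimately show ?thesis by (auto simp: W'_def clinear_scaleC)
  qed
  moreover have "b \<in> W'" using b by (simp add: W'_def)
  moreover have "\<forall>S\<in>set Ts. clinear S" "\<forall>S\<in>set Ts. \<forall>R\<in>set Ts. S \<circ> R = R \<circ> S"
    using Cons.prems(1,2) by (auto simp del: o_apply)
  ultimately obtain a where "a \<in> W'" "a \<noteq> 0" "\<forall>S\<in>set Ts. \<exists>c. S a = c *\<^sub>C a"
    using Cons.IH[of W' b] b(2) by blast
  then show ?case by (auto simp: W'_def)
qed

section \<open>The generated algebra and its characters\<close>

context
  fixes A :: "('x::fd_complex_hilbert \<Rightarrow> 'x) set"
  assumes A: "closed_unital_subalgebra A"
begin

lemma subalgebra_clinear: "S \<in> A \<Longrightarrow> clinear S"
  and subalgebra_id: "id \<in> A"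
  and subalgebra_add: "S \<in> A \<Longrightarrow> R \<in> A \<Longrightarrow> (\<lambda>x. S x + R x) \<in> A"
  and subalgebra_scale: "S \<in> A \<Longrightarrow> (\<lambda>x. c *\<^sub>C S x) \<in> A"
  and subalgebra_comp: "S \<in> A \<Longrightarrow> R \<in> A \<Longrightarrow> S \<circ> R \<in> A"
  using A unfolding closed_unital_subalgebra_def by blast+

lemma subalgebra_closed:
  "(\<And>n. S n \<in> A) \<Longrightarrow> clinear R \<Longrightarrow> (\<lambda>n. onorm (\<lambda>x. S n x - R x)) \<longlonglongrightarrow> 0 \<Longrightarrow> R \<in> A"
  using A unfolding closed_unital_subalgebra_def by blast

lemma subalgebra_diff:
  assumes "S \<in> A" "R \<in> A" shows "(\<lambda>x. S x - R x) \<in> A"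
  using subalgebra_add[OF assms(1) subalgebra_scale[OF assms(2), of "-1"]] by simp

lemma polyop_mem_subalgebra:
  assumes "S \<in> A" shows "polyop S p \<in> A"
proof (induction p)
  case 0
  have "polyop S 0 = (\<lambda>x. 0 *\<^sub>C id x)" by auto
  then show ?case using subalgebra_scale[OF subalgebra_id] by metis
next
  case (pCons a p)
  have "polyop S (pCons a p) = (\<lambda>x. a *\<^sub>C id x + (S \<circ> polyop S p) x)"
    by (auto simp: polyop_pCons[OF subalgebra_clinear[OF assms]])
  then show ?case
    using subalgebra_add subalgebra_scale[OF subalgebra_id] subalgebra_comp[OF assms pCons.IH] by metis
qed

text \<open>An annihilating polynomial of minimal degree has a non-zero constant term when \<open>S\<close> is injective,
  so that it exhibits the inverse of \<open>S\<close> as a polynomial in \<open>S\<close>.\<close>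

lemma subalgebra_inverse:
  assumes S: "S \<in> A" and inj: "\<And>x. S x = 0 \<Longrightarrow> x = 0"
  shows "\<exists>F\<in>A. S \<circ> F = id \<and> F \<circ> S = id"
proof -
  note lin = subalgebra_clinear[OF S]
  define P where "P p \<longleftrightarrow> p \<noteq> 0 \<and> (\<forall>x. polyop S p x = 0)" for p
  obtain p where p: "P p" "\<And>q. P q \<Longrightarrow> degree p \<le> degree q"
    using annihilating_poly[OF lin] ex_has_least_nat[of P _ degree] unfolding P_def by blast
  obtain a q where q: "p = pCons a q" by (metis pCons_cases)
  have eq: "a *\<^sub>C x + S (polyop S q x) = 0" for x
    using p(1) unfolding P_def q polyop_pCons[OF lin] by blast
  show ?thesis
  proof (cases "a = 0")
    case True
    \<comment> \<open>Injectivity cancels the outer \<open>S\<close>, so \<open>q\<close> would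
      annihilate \<open>S\<close> with smaller degree than \<open>p\<close>.\<close>
    then have "P q" using eq inj p(1) q by (auto simp: P_def)
    moreover from this have "degree q < degree p" using q by (simp add: P_def)
    ultimately show ?thesis using p(2) by fastforce
  next
    case False
    define F where "F = polyop S (smult (- 1 / a) q)"
    have "S (F x) = x" for x
    proof -
      have "S (F x) = (- 1 / a) *\<^sub>C S (polyop S q x)"
        unfolding F_def polyop_smult[OF lin] by (rule clinear_scaleC[OF lin])
      also have "S (polyop S q x) = - (a *\<^sub>C x)"
        using eq[of x] by (simp add: eq_neg_iff_add_eq_0 add.commute)
      finally show ?thesis using False by simp
    qed
    moreover have "F (S x) = S (F x)" for x
      unfolding F_def by (simp add: polyop_commute[OF lin])
    moreover have "F \<in> A" unfolding F_def by (rule polyop_mem_subalgebra[OF S])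
    ultimately show ?thesis by (intro bexI[of _ F]) auto
  qed
qed

text \<open>Apply \<open>\<psi>\<close> to \<open>id \<circ> S\<close> for some \<open>S\<close>
  with \<open>\<psi> S \<noteq> 0\<close> and cancel.\<close>

lemma mult_functional_id:
  assumes "mult_functional A \<psi>" shows "\<psi> id = 1"
proof -
  obtain S where S: "S \<in> A" "\<psi> S \<noteq> 0" using assms by (auto simp: mult_functional_def)
  have "\<psi> (id \<circ> S) = \<psi> id * \<psi> S"
    using assms S subalgebra_id unfolding mult_functional_def by blast
  then show ?thesis using S by simp
qed

lemma mult_functional_diff:
  assumes \<psi>: "mult_functional A \<psi>" and "S \<in> A" "R \<in> A"
  shows "\<psi> (\<lambda>x. S x - R x) = \<psi> S - \<psi> R"
proof -
  have "\<psi> (\<lambda>x. S x + (-1) *\<^sub>C R x) = \<psi> S + \<psi> (\<lambda>x. (-1) *\<^sub>C R x)"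
    using \<psi> assms(2) subalgebra_scale[OF assms(3), of "-1"] by (simp only: mult_functional_def)
  also have "\<psi> (\<lambda>x. (-1) *\<^sub>C R x) = (-1) * \<psi> R"
    using \<psi> assms(3) unfolding mult_functional_def by blast
  finally show ?thesis by simp
qed

text \<open>If \<open>\<psi> D = c\<close> exceeds the norm of \<open>D\<close>, then \<open>D - c\<close> is injective, hence invertible in the
  algebra, although \<open>\<psi>\<close> vanishes on it.\<close>

lemma mult_functional_le_onorm:
  assumes \<psi>: "mult_functional A \<psi>" and D: "D \<in> A"
  shows "norm (\<psi> D) \<le> onorm D"
proof (rule ccontr)
  assume less: "\<not> norm (\<psi> D) \<le> onorm D"
  define c where "c = \<psi> D"
  define N where "N = (\<lambda>x. D x - c *\<^sub>C id x)"
  have cid: "(\<lambda>x. c *\<^sub>C id x) \<in> A" by (rule subalgebra_scale[OF subalgebra_id])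
  have N: "N \<in> A" unfolding N_def by (rule subalgebra_diff[OF D cid])
  have "x = 0" if "N x = 0" for x
  proof -
    have "norm c * norm x = norm (D x)" using that by (simp add: N_def flip: norm_scaleC)
    also have "\<dots> \<le> onorm D * norm x" by (rule onorm_clinear[OF subalgebra_clinear[OF D]])
    finally have "(norm c - onorm D) * norm x \<le> 0" by (simp add: algebra_simps)
    then show ?thesis using less by (simp add: c_def mult_le_0_iff)
  qed
  then obtain F where F: "F \<in> A" "N \<circ> F = id" using subalgebra_inverse[OF N] by blast
  have "\<psi> (\<lambda>x. c *\<^sub>C id x) = c * \<psi> id"
    using \<psi> subalgebra_id unfolding mult_functional_def by blast
  then have "\<psi> N = 0"
    unfolding N_def mult_functional_diff[OF \<psi> D cid] by (simp add: c_def mult_functional_id[OF \<psi>])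
  moreover have "\<psi> (N \<circ> F) = \<psi> N * \<psi> F"
    using \<psi> N F unfolding mult_functional_def by blast
  ultimately show False using F mult_functional_id[OF \<psi>] by simp
qed

text \<open>The algebraic clauses are immediate. For limits, contractivity bounds the discrepancy at
  \<open>R\<close> by twice the distance from \<open>S n\<close> to \<open>R\<close>.\<close>

lemma mult_functional_equalizer_subalgebra:
  assumes \<psi>: "mult_functional A \<psi>" and \<psi>': "mult_functional A \<psi>'"
  shows "closed_unital_subalgebra {S \<in> A. \<psi> S = \<psi>' S}"
  unfolding closed_unital_subalgebra_def
proof (intro conjI ballI allI impI)
  let ?E = "{S \<in> A. \<psi> S = \<psi>' S}"
  note ex = \<psi>[unfolded mult_functional_def] \<psi>'[unfolded mult_functional_def]
  show "?E \<subseteq> Collect clinear" using subalgebra_clinear by blast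
  show "id \<in> ?E" using subalgebra_id mult_functional_id[OF \<psi>] mult_functional_id[OF \<psi>'] by simp
  fix S R assume SR: "S \<in> ?E" "R \<in> ?E"
  then show "(\<lambda>x. S x + R x) \<in> ?E" "S \<circ> R \<in> ?E"
    using ex by (simp_all add: subalgebra_add subalgebra_comp)
next
  let ?E = "{S \<in> A. \<psi> S = \<psi>' S}"
  fix c S assume "S \<in> ?E"
  then show "(\<lambda>x. c *\<^sub>C S x) \<in> ?E"
    using \<psi> \<psi>' by (simp add: mult_functional_def subalgebra_scale)
next
  let ?E = "{S \<in> A. \<psi> S = \<psi>' S}"
  fix S R
  assume *: "(\<forall>n. S n \<in> ?E) \<and> clinear R \<and> (\<lambda>n. onorm (\<lambda>x. S n x - R x)) \<longlonglongrightarrow> 0"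
  then have R: "R \<in> A" using subalgebra_closed[of S R] by blast
  have "norm (\<psi>' R - \<psi> R) \<le> 2 * onorm (\<lambda>x. S n x - R x)" for n
  proof -
    have S: "S n \<in> A" "\<psi> (S n) = \<psi>' (S n)" using * by auto
    \<comment> \<open>The two functionals agree at \<open>S n\<close>, so its value cancels.\<close>
    have "\<psi>' R - \<psi> R = \<psi> (\<lambda>x. S n x - R x) - \<psi>' (\<lambda>x. S n x - R x)"
      using S by (simp add: mult_functional_diff[OF \<psi> S(1) R] mult_functional_diff[OF \<psi>' S(1) R])
    also have "norm \<dots> \<le> norm (\<psi> (\<lambda>x. S n x - R x)) + norm (\<psi>' (\<lambda>x. S n x - R x))"
      by (rule norm_triangle_ineq4)
    also have "\<dots> \<le> 2 * onorm (\<lambda>x. S n x - R x)"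
      using mult_functional_le_onorm[OF \<psi> subalgebra_diff[OF S(1) R]]
        mult_functional_le_onorm[OF \<psi>' subalgebra_diff[OF S(1) R]] by simp
    finally show ?thesis .
  qed
  moreover have "(\<lambda>n. 2 * onorm (\<lambda>x. S n x - R x)) \<longlonglongrightarrow> 0"
    using * tendsto_mult_right_zero by blast
  ultimately have "norm (\<psi>' R - \<psi> R) \<le> 0"
    by (intro LIMSEQ_le_const[of "\<lambda>n. 2 * onorm (\<lambda>x. S n x - R x)"]) auto
  then show "R \<in> ?E" using R by simp
qed

end

section \<open>Examples of closed unital algebras\<close>

lemma closed_unital_subalgebra_clinear:
  "closed_unital_subalgebra (Collect clinear :: ('x::fd_complex_hilbert \<Rightarrow> 'x) set)"
  unfolding closed_unital_subalgebra_def
  by (auto simp: clinear_iff scaleC_add_right mult.commute add_ac)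

text \<open>For the closure under limits, being an eigenvector is expressed as the vanishing at
  \<open>S a\<close> of a fixed bounded operator whose kernel is the line through \<open>a\<close>;
  this condition passes to limits.\<close>

lemma closed_unital_subalgebra_eigenvector:
  fixes a :: "'x::fd_complex_hilbert"
  assumes "a \<noteq> 0"
  shows "closed_unital_subalgebra {S. clinear S \<and> (\<exists>c. S a = c *\<^sub>C a)}"
    (is "closed_unital_subalgebra ?E")
  unfolding closed_unital_subalgebra_def
proof (intro conjI ballI allI impI)
  show "?E \<subseteq> Collect clinear" by blast
  show "id \<in> ?E" by (auto simp: clinear_iff intro!: exI[of _ 1])
  fix S R assume SR: "S \<in> ?E" "R \<in> ?E"
  show "(\<lambda>x. S x + R x) \<in> ?E"
    using SR by (auto simp: clinear_iff scaleC_add_right add_ac) (metis scaleC_add_left)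
  show "S \<circ> R \<in> ?E"
    using SR by (auto simp: clinear_iff)
next
  fix c S assume "S \<in> ?E"
  then show "(\<lambda>x. c *\<^sub>C S x) \<in> ?E"
    by (auto simp: clinear_iff scaleC_add_right mult.commute)
next
  fix S R
  assume *: "(\<forall>n. S n \<in> ?E) \<and> clinear R \<and> (\<lambda>n. onorm (\<lambda>x. S n x - R x)) \<longlonglongrightarrow> 0"
  \<comment> \<open>\<open>P\<close> is the squared norm of \<open>a\<close> times the orthogonal
    projection onto the complement of \<open>a\<close>. It is complex linear because
    \<open>cinner\<close> is linear in its first argument.\<close>
  define P where "P y = cinner a a *\<^sub>C y - cinner y a *\<^sub>C a" for y
  have P: "clinear P"
    unfolding clinear_iff P_def
    by (simp add: cinner_add_left cinner_scaleC_left scaleC_add_right scaleC_add_left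
        cvs.scale_right_diff_distrib mult.commute)
  have "norm (P (R a)) \<le> onorm P * (onorm (\<lambda>x. S n x - R x) * norm a)" for n
  proof -
    obtain c where c: "S n a = c *\<^sub>C a" using * by blast
    have lin: "clinear (\<lambda>x. S n x - R x)"
      using * by (auto simp: clinear_iff cvs.scale_right_diff_distrib)
    have "P (S n a) = 0" by (simp add: P_def c cinner_scaleC_left mult.commute)
    then have "norm (P (R a)) = norm (P (S n a - R a))" by (simp add: clinear_diff[OF P])
    also have "\<dots> \<le> onorm P * norm (S n a - R a)" by (rule onorm_clinear[OF P])
    also have "\<dots> \<le> onorm P * (onorm (\<lambda>x. S n x - R x) * norm a)"
      by (intro mult_left_mono onorm_clinear[OF lin] onorm_clinear_nonneg[OF P])
    finally show ?thesis .
  qed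
  moreover have "(\<lambda>n. onorm P * (onorm (\<lambda>x. S n x - R x) * norm a)) \<longlonglongrightarrow> 0"
    using * by (intro tendsto_mult_right_zero tendsto_mult_left_zero) blast
  ultimately have "norm (P (R a)) \<le> 0"
    by (intro LIMSEQ_le_const[of "\<lambda>n. onorm P * (onorm (\<lambda>x. S n x - R x) * norm a)"]) auto
  then have "cinner a a *\<^sub>C R a = cinner (R a) a *\<^sub>C a" by (simp add: P_def)
  moreover have "cinner a a \<noteq> 0" using assms Re_cinner[of a a] by auto
  ultimately have "R a = (cinner (R a) a / cinner a a) *\<^sub>C a"
    by (metis cvs.scale_scale cvs.scale_one divide_inverse_commute left_inverse)
  then show "R \<in> ?E" using * by blast
qed

section \<open>The algebra generated by a tuple and its functionals\<close>

context
  fixes T :: "('x::fd_complex_hilbert \<Rightarrow> 'x) list"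
  assumes T: "set T \<subseteq> Collect clinear"
begin

lemma generated_algebra_subset_clinear: "generated_algebra T \<subseteq> Collect clinear"
  unfolding generated_algebra_def
  by (rule hull_minimal[where S = closed_unital_subalgebra, OF T closed_unital_subalgebra_clinear])

text \<open>Each closure condition passes to intersections. Linearity of the members comes from the
  algebra of all linear maps being one of the sets intersected.\<close>

lemma closed_unital_subalgebra_generated: "closed_unital_subalgebra (generated_algebra T)"
  unfolding closed_unital_subalgebra_def
proof (intro conjI ballI allI impI)
  let ?A = "generated_algebra T"
  show "?A \<subseteq> Collect clinear" by (rule generated_algebra_subset_clinear)
  show "id \<in> ?A" by (auto simp: generated_algebra_def hull_def closed_unital_subalgebra_def)
  fix S R assume "S \<in> ?A" "R \<in> ?A"
  then show "(\<lambda>x. S x + R x) \<in> ?A" "S \<circ> R \<in> ?A"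
    by (auto simp: generated_algebra_def hull_def intro: subalgebra_add subalgebra_comp)
next
  let ?A = "generated_algebra T"
  fix c S assume "S \<in> ?A"
  then show "(\<lambda>x. c *\<^sub>C S x) \<in> ?A"
    by (auto simp: generated_algebra_def hull_def intro: subalgebra_scale)
next
  let ?A = "generated_algebra T"
  fix S R
  assume "(\<forall>n. S n \<in> ?A) \<and> clinear R \<and> (\<lambda>n. onorm (\<lambda>x. S n x - R x)) \<longlonglongrightarrow> 0"
  then show "R \<in> ?A"
    by (auto simp: generated_algebra_def hull_def intro: subalgebra_closed[of _ S])
qed

text \<open>The set where both functionals agree is a closed unital algebra containing the
  generators, hence everything; off the algebra, extensionality decides. This justifies the
  \<open>THE\<close> in \<open>joint_functional\<close>.\<close>

lemma mult_functional_unique: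
  assumes \<psi>: "mult_functional (generated_algebra T) \<psi>"
    and \<psi>': "mult_functional (generated_algebra T) \<psi>'"
    and eq: "map \<psi> T = map \<psi>' T"
  shows "\<psi> = \<psi>'"
proof (rule extensionalityI)
  let ?A = "generated_algebra T"
  let ?E = "{S \<in> ?A. \<psi> S = \<psi>' S}"
  show "\<psi> \<in> extensional ?A" "\<psi>' \<in> extensional ?A"
    using \<psi> \<psi>' by (simp_all add: mult_functional_def)
  have "set T \<subseteq> ?E"
    using eq hull_subset[of "set T"] by (auto simp: generated_algebra_def)
  then have "?A \<subseteq> ?E"
    using mult_functional_equalizer_subalgebra[OF closed_unital_subalgebra_generated \<psi> \<psi>']
    unfolding generated_algebra_def[of T] by (intro hull_minimal)
  then show "\<psi> S = \<psi>' S" if "S \<in> ?A" for S using that by blast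
qed

text \<open>Every member of the algebra has \<open>a\<close> as an eigenvector. Its eigenvalue there
  is a multiplicative functional with values \<open>\<mu>s\<close> on the generators, so uniqueness
  identifies it with \<open>joint_functional\<close>.\<close>

lemma joint_functional_eigenvector:
  assumes a: "joint_eigenvector T \<mu>s a" and S: "S \<in> generated_algebra T"
  shows "S a = joint_functional T \<mu>s S *\<^sub>C a"
proof -
  let ?A = "generated_algebra T"
  have a0: "a \<noteq> 0" and len: "length \<mu>s = length T"
    and ev: "\<And>j. j < length T \<Longrightarrow> (T ! j) a = (\<mu>s ! j) *\<^sub>C a"
    using a by (auto simp: joint_eigenvector_def)
  have sub: "?A \<subseteq> {S. clinear S \<and> (\<exists>c. S a = c *\<^sub>C a)}"
    unfolding generated_algebra_def
  proof (rule hull_minimal[where S = closed_unital_subalgebra,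
        OF _ closed_unital_subalgebra_eigenvector[OF a0]])
    show "set T \<subseteq> {S. clinear S \<and> (\<exists>c. S a = c *\<^sub>C a)}"
      using T ev by (force simp: in_set_conv_nth)
  qed
  \<comment> \<open>The chosen eigenvalue is unique as \<open>a\<close> is non-zero; restricting to
    \<open>?A\<close> makes the functional extensional.\<close>
  define \<psi> where "\<psi> = (\<lambda>S\<in>?A. SOME c. S a = c *\<^sub>C a)"
  have \<psi>: "S a = \<psi> S *\<^sub>C a" if "S \<in> ?A" for S
    using someI_ex[of "\<lambda>c. S a = c *\<^sub>C a"] that sub by (auto simp: \<psi>_def)
  have \<psi>_eq: "\<psi> S = c" if "S \<in> ?A" "S a = c *\<^sub>C a" for S c
    using \<psi>[OF that(1)] that(2) a0 by simp
  note alg = closed_unital_subalgebra_generated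
  have "mult_functional ?A \<psi>"
    unfolding mult_functional_def
  proof (intro conjI ballI allI)
    show "\<psi> \<in> extensional ?A" by (simp add: \<psi>_def)
    fix S R assume SR: "S \<in> ?A" "R \<in> ?A"
    show "\<psi> (\<lambda>x. S x + R x) = \<psi> S + \<psi> R"
      using \<psi>[OF SR(1)] \<psi>[OF SR(2)]
      by (intro \<psi>_eq subalgebra_add[OF alg SR]) (simp add: scaleC_add_left)
    have "S (R a) = (\<psi> S * \<psi> R) *\<^sub>C a"
      using clinear_scaleC[OF subalgebra_clinear[OF alg SR(1)], of "\<psi> R" a]
        \<psi>[OF SR(1)] \<psi>[OF SR(2)] by (simp add: mult.commute)
    then show "\<psi> (S \<circ> R) = \<psi> S * \<psi> R"
      by (intro \<psi>_eq subalgebra_comp[OF alg SR]) simp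
  next
    fix c S assume "S \<in> ?A"
    then show "\<psi> (\<lambda>x. c *\<^sub>C S x) = c * \<psi> S"
      by (intro \<psi>_eq subalgebra_scale[OF alg]) (simp_all add: \<psi>)
  next
    have "\<psi> id = 1" using \<psi>_eq[OF subalgebra_id[OF alg]] by simp
    then show "\<exists>S\<in>?A. \<psi> S \<noteq> 0" using subalgebra_id[OF alg] by force
  qed
  moreover have "\<mu>s = map \<psi> T"
  proof (rule nth_equalityI)
    fix j assume "j < length \<mu>s"
    then show "\<mu>s ! j = map \<psi> T ! j"
      using len ev \<psi>_eq[of "T ! j" "\<mu>s ! j"] hull_inc[of "T ! j" "set T"]
      by (simp add: generated_algebra_def)
  qed (simp add: len)
  ultimately have "joint_functional T \<mu>s = \<psi>"
    unfolding joint_functional_def using mult_functional_unique by (intro the_equality) auto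
  then show ?thesis using \<psi>[OF S] by simp
qed

end

section \<open>The linear part of a representation by affine isometries\<close>

text \<open>Evaluation at 0 shows that every decomposition of \<open>f\<close> has translation part
  \<open>f 0\<close>, so the linear part is determined.\<close>

lemma linear_part_eqI:
  assumes "linear_isometry U" "\<And>x. f x = U x + b"
  shows "linear_part f = U"
  unfolding linear_part_def
proof (rule the_equality)
  show "linear_isometry U \<and> (\<exists>b. \<forall>x. f x = U x + b)" using assms by blast
  fix V assume "linear_isometry V \<and> (\<exists>b. \<forall>x. f x = V x + b)"
  then obtain c where V: "linear_isometry V" "\<And>x. f x = V x + c" by blast
  have "U 0 = 0" "V 0 = 0" using assms(1) V(1) by (auto simp: linear_isometry_def clinear_0)
  then have "b = c" using assms(2)[of 0] V(2)[of 0] by simp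
  then show "V = U" using assms(2) V(2) by (metis add_right_cancel ext)
qed

context
  fixes \<tau> :: "'g::ab_group_add \<Rightarrow> 'x::fd_complex_hilbert \<Rightarrow> 'x"
  assumes \<tau>: "isom_hom \<tau>"
begin

lemma lin_rep_affine: "linear_isometry (lin_rep \<tau> \<gamma>) \<and> (\<exists>b. \<forall>x. \<tau> \<gamma> x = lin_rep \<tau> \<gamma> x + b)"
proof -
  obtain U b where "linear_isometry U" "\<forall>x. \<tau> \<gamma> x = U x + b"
    using \<tau> unfolding isom_hom_def Isom_def by blast
  moreover from this have "lin_rep \<tau> \<gamma> = U" unfolding lin_rep_def by (intro linear_part_eqI) auto
  ultimately show ?thesis by blast
qed

lemma lin_rep_clinear: "clinear (lin_rep \<tau> \<gamma>)"
  and norm_lin_rep: "norm (lin_rep \<tau> \<gamma> x) = norm x"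
  using lin_rep_affine[of \<gamma>] by (auto simp: linear_isometry_def)

lemma lin_rep_add: "lin_rep \<tau> (\<gamma> + \<delta>) = lin_rep \<tau> \<gamma> \<circ> lin_rep \<tau> \<delta>"
proof -
  obtain b where b: "\<And>x. \<tau> \<gamma> x = lin_rep \<tau> \<gamma> x + b" using lin_rep_affine by blast
  obtain c where c: "\<And>x. \<tau> \<delta> x = lin_rep \<tau> \<delta> x + c" using lin_rep_affine by blast
  have "\<tau> (\<gamma> + \<delta>) x = (lin_rep \<tau> \<gamma> \<circ> lin_rep \<tau> \<delta>) x + (lin_rep \<tau> \<gamma> c + b)" for x
  proof -
    have "\<tau> (\<gamma> + \<delta>) x = \<tau> \<gamma> (\<tau> \<delta> x)" using \<tau> by (simp add: isom_hom_def)
    then show ?thesis by (simp add: b c clinear_add[OF lin_rep_clinear] add.assoc)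
  qed
  moreover have "linear_isometry (lin_rep \<tau> \<gamma> \<circ> lin_rep \<tau> \<delta>)"
    unfolding linear_isometry_def clinear_iff
    by (simp add: norm_lin_rep clinear_add[OF lin_rep_clinear] clinear_scaleC[OF lin_rep_clinear])
  ultimately show ?thesis unfolding lin_rep_def[of _ "\<gamma> + \<delta>"] by (intro linear_part_eqI)
qed

lemma lin_rep_eq_0_iff: "lin_rep \<tau> \<gamma> x = 0 \<longleftrightarrow> x = 0"
  by (metis norm_eq_zero norm_lin_rep)

text \<open>\<open>isom_hom\<close> states only additivity. It makes \<open>lin_rep \<tau> 0\<close>
  idempotent, and an injective idempotent is the identity.\<close>

lemma lin_rep_0: "lin_rep \<tau> 0 = id"
proof
  fix x
  have "lin_rep \<tau> 0 (lin_rep \<tau> 0 x) = lin_rep \<tau> 0 x"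
    using lin_rep_add[of 0 0] by (metis add_0 comp_apply)
  then have "lin_rep \<tau> 0 (lin_rep \<tau> 0 x - x) = 0" by (simp add: clinear_diff[OF lin_rep_clinear])
  then show "lin_rep \<tau> 0 x = id x" by (simp add: lin_rep_eq_0_iff)
qed

lemma lin_rep_Bij: "lin_rep \<tau> \<gamma> \<in> Bij UNIV"
proof -
  have "lin_rep \<tau> \<gamma> \<circ> lin_rep \<tau> (- \<gamma>) = id" "lin_rep \<tau> (- \<gamma>) \<circ> lin_rep \<tau> \<gamma> = id"
    by (simp_all add: lin_rep_0 flip: lin_rep_add)
  then show ?thesis using o_bij by (auto simp: Bij_def)
qed

lemma set_lin_tuple_clinear: "set (lin_tuple \<tau> \<gamma>s) \<subseteq> Collect clinear"
  by (auto simp: lin_tuple_def lin_rep_clinear)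

section \<open>The represented group inside the generated algebra, and its joint characters\<close>

text \<open>Induction over the generated group. Inverses are the only point beyond the algebra
  operations: a generator is isometric, hence injective, so its inverse already lies in the
  algebra.\<close>

lemma lin_rep_mem_generated_algebra:
  assumes gen: "generating_tuple \<tau> \<gamma>s"
  shows "lin_rep \<tau> \<gamma> \<in> generated_algebra (lin_tuple \<tau> \<gamma>s)"
proof -
  let ?A = "generated_algebra (lin_tuple \<tau> \<gamma>s)" and ?G = "BijGroup UNIV"
  note alg = closed_unital_subalgebra_generated[OF set_lin_tuple_clinear, of \<gamma>s]
  have range: "generate ?G (set (lin_tuple \<tau> \<gamma>s)) = range (lin_rep \<tau>)"
    using gen by (simp add: generating_tuple_def)
  have base: "S \<in> ?A" if "S \<in> set (lin_tuple \<tau> \<gamma>s)" for S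
    using that by (simp add: generated_algebra_def hull_inc)
  have "S \<in> ?A" if "S \<in> generate ?G (set (lin_tuple \<tau> \<gamma>s))" for S
    using that
  proof induction
    case one
    then show ?case using subalgebra_id[OF alg] by (simp add: BijGroup_def id_def)
  next
    case (incl h)
    then show ?case by (rule base)
  next
    case (inv h)
    then obtain \<delta> where h: "h = lin_rep \<tau> \<delta>" by (auto simp: lin_tuple_def)
    obtain F where F: "F \<in> ?A" "h \<circ> F = id" "F \<circ> h = id"
      using subalgebra_inverse[OF alg base[OF inv]] by (auto simp: h lin_rep_eq_0_iff)
    have "inv\<^bsub>?G\<^esub> h = inv_into UNIV h"
      using lin_rep_Bij[of \<delta>] by (simp add: h inv_BijGroup restrict_UNIV)
    also have "\<dots> = F" using F by (metis inv_unique_comp)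
    finally show ?case using F by simp
  next
    case (eng h1 h2)
    \<comment> \<open>The product of \<open>BijGroup\<close> is composition only on bijections; the
      generated elements are bijective because they lie in the range of
      \<open>lin_rep \<tau>\<close>.\<close>
    then have "h1 \<in> Bij UNIV" "h2 \<in> Bij UNIV"
      unfolding range using lin_rep_Bij by blast+
    then have "h1 \<otimes>\<^bsub>?G\<^esub> h2 = h1 \<circ> h2"
      by (simp add: BijGroup_def compose_def fun_eq_iff)
    then show ?case using subalgebra_comp[OF alg eng.IH] by (simp del: o_apply)
  qed
  then show ?thesis unfolding range by blast
qed

lemma lin_rep_joint_eigenvector:
  assumes "generating_tuple \<tau> \<gamma>s" "joint_eigenvector (lin_tuple \<tau> \<gamma>s) \<mu>s a"
  shows "lin_rep \<tau> \<gamma> a = chi_joint \<tau> \<gamma>s \<mu>s \<gamma> *\<^sub>C a"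
  using joint_functional_eigenvector[OF set_lin_tuple_clinear assms(2)
      lin_rep_mem_generated_algebra[OF assms(1)]]
  by (simp add: chi_joint_def)

text \<open>Both properties are read off at a joint eigenvector: isometry gives modulus 1, and
  composition of operators gives products of eigenvalues.\<close>

lemma chi_joint_dual_group:
  assumes "generating_tuple \<tau> \<gamma>s" "\<mu>s \<in> joint_spectrum (lin_tuple \<tau> \<gamma>s)"
  shows "chi_joint \<tau> \<gamma>s \<mu>s \<in> dual_group"
proof -
  let ?\<chi> = "chi_joint \<tau> \<gamma>s \<mu>s"
  obtain a where a: "joint_eigenvector (lin_tuple \<tau> \<gamma>s) \<mu>s a"
    using assms(2) by (auto simp: joint_spectrum_def)
  then have a0: "a \<noteq> 0" by (simp add: joint_eigenvector_def)
  note ev = lin_rep_joint_eigenvector[OF assms(1) a]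
  have "norm (?\<chi> \<gamma>) = 1" for \<gamma>
    using norm_lin_rep[of \<gamma> a] a0 by (simp add: ev norm_scaleC)
  moreover have "?\<chi> (\<gamma> + \<delta>) = ?\<chi> \<gamma> * ?\<chi> \<delta>" for \<gamma> \<delta>
  proof -
    have "?\<chi> (\<gamma> + \<delta>) *\<^sub>C a = lin_rep \<tau> \<gamma> (lin_rep \<tau> \<delta> a)"
      using lin_rep_add[of \<gamma> \<delta>] by (simp flip: ev)
    also have "\<dots> = (?\<chi> \<gamma> * ?\<chi> \<delta>) *\<^sub>C a"
      by (simp add: ev clinear_scaleC[OF lin_rep_clinear] mult.commute)
    finally show ?thesis using a0 by simp
  qed
  ultimately show ?thesis by (simp add: dual_group_def)
qed

text \<open>Since the group is abelian the operators commute, and the whole non-zero space serves as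
  the invariant subspace for a common eigenvector.\<close>

lemma joint_spectrum_lin_tuple_nonempty:
  assumes "x \<noteq> (0::'x)"
  shows "joint_spectrum (lin_tuple \<tau> \<gamma>s) \<noteq> {}"
proof -
  let ?T = "lin_tuple \<tau> \<gamma>s"
  have "\<exists>a\<in>UNIV. a \<noteq> 0 \<and> (\<forall>S\<in>set ?T. \<exists>c. S a = c *\<^sub>C a)"
  proof (rule common_eigenvector[OF _ _ cvs.subspace_UNIV _ UNIV_I assms])
    show "\<forall>S\<in>set ?T. \<forall>R\<in>set ?T. S \<circ> R = R \<circ> S"
      by (auto simp: lin_tuple_def add.commute simp flip: lin_rep_add)
  qed (use set_lin_tuple_clinear in auto)
  then obtain a where a: "a \<noteq> 0" "\<forall>S\<in>set ?T. \<exists>c. S a = c *\<^sub>C a" by blast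
  then obtain c where "\<forall>S\<in>set ?T. S a = c S *\<^sub>C a" by metis
  then have "joint_eigenvector ?T (map c ?T) a"
    using a by (simp add: joint_eigenvector_def)
  then show ?thesis by (auto simp: joint_spectrum_def)
qed

end

section \<open>Constant vectors in the kernel of the orbit matrix\<close>

lemma cnj_char_dual_group: "\<chi> \<in> dual_group \<Longrightarrow> cnj_char \<chi> \<in> dual_group"
  by (simp add: dual_group_def cnj_char_def)

theorem theorem2p8:
  fixes G :: "('v, 'e) pre_digraph"
    and m :: "'e \<Rightarrow> 'g::ab_group_add"
    and \<phi> :: "'e \<Rightarrow> 'x::fd_complex_hilbert \<Rightarrow> 'y::fd_complex_hilbert"
    and \<tau> :: "'g \<Rightarrow> 'x \<Rightarrow> 'x"
    and \<gamma>s :: "'g list"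
  assumes "\<exists>S::'g set. finite S \<and> group_closure S = UNIV"
    and "\<exists>x::'x. x \<noteq> 0"
    and "gain_framework G m \<phi> \<tau>"
    and "generating_tuple \<tau> \<gamma>s"
  shows "(\<forall>\<mu>s \<in> joint_spectrum (lin_tuple \<tau> \<gamma>s). \<forall>a. joint_eigenvector (lin_tuple \<tau> \<gamma>s) \<mu>s a \<longrightarrow>
            (\<lambda>v\<in>verts G. a) \<in> orbit_kernel G m \<phi> \<tau> (cnj_char (chi_joint \<tau> \<gamma>s \<mu>s)))
         \<and> Omega_js \<tau> \<gamma>s \<noteq> {} \<and> Omega_js \<tau> \<gamma>s \<subseteq> RUM_spectrum G m \<phi> \<tau>"
proof -
  let ?T = "lin_tuple \<tau> \<gamma>s"
  have \<tau>: "isom_hom \<tau>" and \<phi>: "\<And>e. e \<in> arcs G \<Longrightarrow> clinear (\<phi> e)"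
    and G: "fin_digraph G" "verts G \<noteq> {}"
    using assms(3) by (auto simp: gain_framework_def)
  have dual: "chi_joint \<tau> \<gamma>s \<mu>s \<in> dual_group" if "\<mu>s \<in> joint_spectrum ?T" for \<mu>s
    by (rule chi_joint_dual_group[OF \<tau> assms(4) that])
  have kernel: "(\<lambda>v\<in>verts G. a) \<in> orbit_kernel G m \<phi> \<tau> (cnj_char (chi_joint \<tau> \<gamma>s \<mu>s))"
    if a: "joint_eigenvector ?T \<mu>s a" for \<mu>s a
  proof -
    let ?\<chi> = "chi_joint \<tau> \<gamma>s \<mu>s"
    have "norm (?\<chi> \<gamma>) = 1" for \<gamma>
      using dual[of \<mu>s] a by (auto simp: joint_spectrum_def dual_group_def)
    \<comment> \<open>On the unit circle the conjugate is the inverse, so the conjugate character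
      cancels the eigenvalue and each row becomes \<open>\<phi> e (a - a) = 0\<close>.\<close>
    then have "cnj (?\<chi> \<gamma>) * ?\<chi> \<gamma> = 1" for \<gamma>
      using complex_norm_square[of "?\<chi> \<gamma>"] by (simp add: mult.commute)
    then have "cnj_char ?\<chi> \<gamma> *\<^sub>C lin_rep \<tau> \<gamma> a = a" for \<gamma>
      by (simp add: cnj_char_def lin_rep_joint_eigenvector[OF \<tau> assms(4) a])
    \<comment> \<open>At both ends of an edge the restricted constant function takes the value
      \<open>a\<close>.\<close>
    moreover have "tail G e \<in> verts G" "head G e \<in> verts G" if "e \<in> arcs G" for e
      using G(1) that by (auto simp: fin_digraph_def wf_digraph_def)
    ultimately show ?thesis
      by (auto simp: orbit_kernel_def orbit_matrix_def clinear_0[OF \<phi>] intro!: restrict_ext)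
  qed
  have "Omega_js \<tau> \<gamma>s \<subseteq> RUM_spectrum G m \<phi> \<tau>"
  proof
    fix \<chi> assume "\<chi> \<in> Omega_js \<tau> \<gamma>s"
    then obtain \<mu>s where \<mu>s: "\<chi> = cnj_char (chi_joint \<tau> \<gamma>s \<mu>s)" "\<mu>s \<in> joint_spectrum ?T"
      by (auto simp: Omega_js_def)
    then obtain a where a: "joint_eigenvector ?T \<mu>s a" by (auto simp: joint_spectrum_def)
    \<comment> \<open>Besides \<open>a \<noteq> 0\<close> this needs a vertex at which the two
      functions differ.\<close>
    have "(\<lambda>v\<in>verts G. a) \<noteq> (\<lambda>v\<in>verts G. 0)"
      using a G(2) by (auto simp: joint_eigenvector_def restrict_def fun_eq_iff)
    then show "\<chi> \<in> RUM_spectrum G m \<phi> \<tau>"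
      using kernel[OF a] cnj_char_dual_group[OF dual[OF \<mu>s(2)]] \<mu>s(1)
      by (auto simp: RUM_spectrum_def)
  qed
  moreover have "Omega_js \<tau> \<gamma>s \<noteq> {}"
    using joint_spectrum_lin_tuple_nonempty[OF \<tau>] assms(2) by (auto simp: Omega_js_def)
  ultimately show ?thesis using kernel by blast
qed

end
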